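(* Let $\Phi=(\phi_n)$ be a frame for $\mathcal H$ with bounds $A_\Phi,B_\Phi$, and let $\Psi=(\psi_n)$ be a sequence in $\mathcal H$, with $\phi_n\neq0$, $\psi_n\neq 0$ for all $n$. Assume that $\Psi-\Phi=(\psi_n-\phi_n)$ is a Bessel sequence for $\mathcal H$ with bound $B_{\Psi-\Phi}<\frac{A_\Phi^2}{B_\Phi}$. For every positive (or negative) semi-normalized sequence $m=(m_n)$ satisfying $$0<a\le|m_n|\le b\ \ \forall n,\quad\text{and}\quad\frac ba<\frac{A_\Phi}{\sqrt{B_{\Psi-\Phi}B_\Phi}},$$ it follows that $\Psi$ is a frame for $\mathcal H$, the multipliers $M_{m,\Phi,\Psi}$ and $M_{m,\Psi,\Phi}$ are invertible on $\mathcal H$ and, for all $h\in\mathcal H$, $$\frac{1}{bB_\Phi+b\sqrt{B_\Phi B_{\Psi-\Phi}}}\|h\|\le\|M^{-1}h\|\le\frac{1}{aA_\Phi-b\sqrt{B_\Phi B_{\Psi-\Phi}}}\|h\|,$$ $$M^{-1}=\begin{cases}\sum_{k=0}^\infty[S_{(\sqrt{m_n}\phi_n)}^{-1}(S_{(\sqrt{m_n}\phi_n)}-M)]^kS_{(\sqrt{m_n}\phi_n)}^{-1},&\text{if }m_n>0\ \forall n,\\-\sum_{k=0}^\infty[S_{(\sqrt{|m_n|}\phi_n)}^{-1}(S_{(\sqrt{|m_n|}\phi_n)}+M)]^kS_{(\sqrt{|m_n|}\phi_n)}^{-1},&\text{if }m_n<0\ \forall n,\end{cases}$$ where $M$ denotes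 any one of $M_{m,\Phi,\Psi}$ and $M_{m,\Psi,\Phi}$.
   Context: $\mathcal H$ is a separable infinite-dimensional complex Hilbert space, inner product linear in the first argument; all sequences are indexed by $\mathbb N$. The multiplier is $M_{m,\Phi,\Psi}f=\sum_n m_n\langle f,\psi_n\rangle\phi_n$; it is invertible on $\mathcal H$ if the series converges for every $f\in\mathcal H$ and the resulting operator has a bounded two-sided inverse $\mathcal H\to\mathcal H$. $\Phi$ is Bessel for $\mathcal H$ with bound $B>0$ if $\sum|\langle h,\phi_n\rangle|^2\le B\|h\|^2$ for all $h\in\mathcal H$; it is a frame with bounds $A_\Phi,B_\Phi$ if it is Bessel with bound $B_\Phi$, $A_\Phi>0$, and $A_\Phi\|h\|^2\le\sum|\langle h,\phi_n\rangle|^2$ for all $h\in\mathcal H$. The frame operator of a frame $\Phi$ is $S_\Phi h=\sum\langle h,\phi_n\rangle\phi_n$, which is invertible on $\mathcal H$. A scalar sequence $m$ is semi-normalized if $0<a\le|m_n|\le b<\infty$ for all $n$ for some constants $a,b$ (for such $m$, $(\sqrt{|m_n|}\,\phi_n)$ is again a frame); positive (negative) means $m_n>0$ ($m_n<0$) for all $n$. Infinite series of operators are understood as converging in operator norm. *)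

theory Defs
  imports "HOL-Analysis.Analysis"
begin

text \<open>
  Complex Hilbert spaces are types, in the same style as the library's \<open>real_inner\<close>; the real
  normed structure (hence topology, \<open>summable\<close>, \<open>bounded_linear\<close>, \<open>onorm\<close>) is the one obtained by
  restricting scalars. The inner product is linear in its first argument.
\<close>

class complex_hilbert = real_normed_vector + complete_space +
  fixes scaleC :: "complex \<Rightarrow> 'a \<Rightarrow> 'a" (infixr \<open>*\<^sub>C\<close> 75)
    and cinner :: "'a \<Rightarrow> 'a \<Rightarrow> complex"
  assumes scaleC_add_right: "c *\<^sub>C (x + y) = c *\<^sub>C x + c *\<^sub>C y"
    and scaleC_add_left: "(c + d) *\<^sub>C x = c *\<^sub>C x + d *\<^sub>C x"
    and scaleC_scaleC: "c *\<^sub>C d *\<^sub>C x = (c * d) *\<^sub>C x"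
    and scaleC_one: "1 *\<^sub>C x = x"
    and scaleR_scaleC: "r *\<^sub>R x = complex_of_real r *\<^sub>C x"
    and cinner_add_left: "cinner (x + y) z = cinner x z + cinner y z"
    and cinner_scaleC_left: "cinner (c *\<^sub>C x) y = c * cinner x y"
    and cinner_commute: "cinner x y = cnj (cinner y x)"
    and norm_eq_sqrt_cinner: "norm x = sqrt (Re (cinner x x))"

global_interpretation complex_vector: vector_space "scaleC :: complex \<Rightarrow> 'a \<Rightarrow> 'a::complex_hilbert"
  defines cspan = complex_vector.span
  by unfold_locales (simp_all add: scaleC_add_right scaleC_add_left scaleC_scaleC scaleC_one)

definition cinfinite_dimensional :: "'a::complex_hilbert itself \<Rightarrow> bool" where
  "cinfinite_dimensional _ \<longleftrightarrow> (\<forall>B :: 'a set. finite B \<longrightarrow> cspan B \<noteq> UNIV)"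

definition bounded_clinear :: "('a::complex_hilbert \<Rightarrow> 'a) \<Rightarrow> bool" where
  "bounded_clinear T \<longleftrightarrow> bounded_linear T \<and> (\<forall>c x. T (c *\<^sub>C x) = c *\<^sub>C T x)"

definition bessel_bound :: "(nat \<Rightarrow> 'a::complex_hilbert) \<Rightarrow> real \<Rightarrow> bool" where
  "bessel_bound \<Phi> B \<longleftrightarrow> 0 < B \<and>
     (\<forall>h. summable (\<lambda>n. (cmod (cinner h (\<Phi> n)))\<^sup>2) \<and>
          (\<Sum>n. (cmod (cinner h (\<Phi> n)))\<^sup>2) \<le> B * (norm h)\<^sup>2)"

definition frame_bounds :: "(nat \<Rightarrow> 'a::complex_hilbert) \<Rightarrow> real \<Rightarrow> real \<Rightarrow> bool" where
  "frame_bounds \<Phi> A B \<longleftrightarrow> bessel_bound \<Phi> B \<and> 0 < A \<and>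
     (\<forall>h. A * (norm h)\<^sup>2 \<le> (\<Sum>n. (cmod (cinner h (\<Phi> n)))\<^sup>2))"

definition is_frame :: "(nat \<Rightarrow> 'a::complex_hilbert) \<Rightarrow> bool" where
  "is_frame \<Phi> \<longleftrightarrow> (\<exists>A B. frame_bounds \<Phi> A B)"

definition frame_operator :: "(nat \<Rightarrow> 'a::complex_hilbert) \<Rightarrow> 'a \<Rightarrow> 'a" where
  "frame_operator \<Phi> h = (\<Sum>n. cinner h (\<Phi> n) *\<^sub>C \<Phi> n)"

definition multiplier ::
  "(nat \<Rightarrow> complex) \<Rightarrow> (nat \<Rightarrow> 'a::complex_hilbert) \<Rightarrow> (nat \<Rightarrow> 'a) \<Rightarrow> 'a \<Rightarrow> 'a" where
  "multiplier m \<Phi> \<Psi> f = (\<Sum>n. m n *\<^sub>C cinner f (\<Psi> n) *\<^sub>C \<Phi> n)"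

definition invertible_multiplier ::
  "(nat \<Rightarrow> complex) \<Rightarrow> (nat \<Rightarrow> 'a::complex_hilbert) \<Rightarrow> (nat \<Rightarrow> 'a) \<Rightarrow> bool" where
  "invertible_multiplier m \<Phi> \<Psi> \<longleftrightarrow>
     (\<forall>f. summable (\<lambda>n. m n *\<^sub>C cinner f (\<Psi> n) *\<^sub>C \<Phi> n)) \<and>
     (\<exists>T. bounded_clinear T \<and>
        (\<forall>f. T (multiplier m \<Phi> \<Psi> f) = f) \<and> (\<forall>f. multiplier m \<Phi> \<Psi> (T f) = f))"

text \<open>
  Convergence of a series of operators in operator norm. Boundedness is part of the definition
  because \<open>onorm\<close> is only meaningful for bounded operators.
\<close>

definition op_sums :: "(nat \<Rightarrow> 'a::complex_hilbert \<Rightarrow> 'a) \<Rightarrow> ('a \<Rightarrow> 'a) \<Rightarrow> bool" where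
  "op_sums F T \<longleftrightarrow> (\<forall>k. bounded_clinear (F k)) \<and> bounded_clinear T \<and>
     (\<lambda>N. onorm (\<lambda>h. (\<Sum>k<N. F k h) - T h)) \<longlonglongrightarrow> 0"

end

theory Submission
  imports Defs
begin

text \<open>
  With \<open>w\<^sub>n = \<bar>m\<^sub>n\<bar>\<close>, the operator \<open>S = M\<^bsub>w,\<Phi>,\<Phi>\<^esub>\<close> is the frame operator of \<open>(\<surd>w\<^sub>n \<phi>\<^sub>n)\<close>; it is
  coercive with constant \<open>a A\<^sub>\<Phi>\<close>, hence bijective. Both \<open>S - M\<^bsub>w,\<Phi>,\<Psi>\<^esub> = M\<^bsub>w,\<Phi>,\<Phi>-\<Psi>\<^esub>\<close> and
  \<open>S - M\<^bsub>w,\<Psi>,\<Phi>\<^esub> = M\<^bsub>w,\<Phi>-\<Psi>,\<Phi>\<^esub>\<close> have norm at most \<open>\<mu> = b \<surd>(B\<^sub>\<Phi> B\<^sub>\<Delta>) < a A\<^sub>\<Phi>\<close>, so the multipliers are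
  small perturbations of \<open>S\<close> and are inverted by a Neumann series. The lower frame bound of \<open>\<Psi>\<close>
  comes from \<open>(a A\<^sub>\<Phi> - \<mu>) \<parallel>h\<parallel> \<le> \<parallel>M\<^bsub>w,\<Phi>,\<Psi>\<^esub> h\<parallel> \<le> b \<surd>B\<^sub>\<Phi> (\<Sum> \<bar>\<langle>h, \<psi>\<^sub>n\<rangle>\<bar>\<^sup>2)\<^sup>1\<^sup>/\<^sup>2\<close>.
\<close>

section \<open>Inner product, norm and Cauchy-Schwarz\<close>

instance complex_hilbert \<subseteq> banach ..

lemma scaleC_minus_left [simp]: "(- c) *\<^sub>C x = - (c *\<^sub>C (x::'a::complex_hilbert))"
  by (rule complex_vector.scale_minus_left)

lemma scaleC_diff_right: "c *\<^sub>C (x - y) = c *\<^sub>C x - c *\<^sub>C (y::'a::complex_hilbert)"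
  by (rule complex_vector.scale_right_diff_distrib)

lemma cinner_zero_left [simp]: "cinner 0 (y::'a::complex_hilbert) = 0"
  using cinner_add_left[of 0 0 y] by simp

lemma cinner_zero_right [simp]: "cinner (y::'a::complex_hilbert) 0 = 0"
  by (subst cinner_commute) simp

lemma cinner_minus_left [simp]: "cinner (- x) (y::'a::complex_hilbert) = - cinner x y"
  using cinner_add_left[of x "- x" y] by (simp add: add_eq_0_iff)

lemma cinner_diff_left: "cinner (x - z) (y::'a::complex_hilbert) = cinner x y - cinner z y"
  using cinner_add_left[of x "- z" y] by simp

lemma cinner_add_right: "cinner (y::'a::complex_hilbert) (x + z) = cinner y x + cinner y z"
  by (metis cinner_add_left cinner_commute complex_cnj_add)

lemma cinner_minus_right [simp]: "cinner (y::'a::complex_hilbert) (- x) = - cinner y x"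
  using cinner_add_right[of y x "- x"] by (simp add: add_eq_0_iff)

lemma cinner_diff_right: "cinner (y::'a::complex_hilbert) (x - z) = cinner y x - cinner y z"
  using cinner_add_right[of y x "- z"] by simp

lemma cinner_scaleC_right: "cinner (x::'a::complex_hilbert) (c *\<^sub>C y) = cnj c * cinner x y"
  by (metis cinner_commute cinner_scaleC_left complex_cnj_mult)

lemma cinner_sum_left: "cinner (sum f I) (y::'a::complex_hilbert) = (\<Sum>i\<in>I. cinner (f i) y)"
  by (induction I rule: infinite_finite_induct) (simp_all add: cinner_add_left)

lemma cinner_self: "cinner x x = complex_of_real ((norm (x::'a::complex_hilbert))\<^sup>2)"
proof -
  \<comment> \<open>Real \<open>sqrt\<close> is negative on negative arguments, so nonnegativity of
    the norm is what excludes a negative \<open>Re (cinner x x)\<close>; positivity of the form is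
    thereby derived from the norm axiom.\<close>
  have "0 \<le> sqrt (Re (cinner x x))"
    by (metis norm_eq_sqrt_cinner norm_ge_zero)
  then have "Re (cinner x x) = (norm x)\<^sup>2"
    by (simp add: norm_eq_sqrt_cinner)
  moreover have "Im (cinner x x) = 0"
    using arg_cong[OF cinner_commute[of x x], of Im] by simp
  ultimately show ?thesis
    by (simp add: complex_eq_iff)
qed

lemma norm_diff_sq:
  "(norm (x - y))\<^sup>2 = (norm x)\<^sup>2 - 2 * Re (cinner x y) + (norm (y::'a::complex_hilbert))\<^sup>2"
proof -
  have "Re (cinner y x) = Re (cinner x y)"
    by (subst cinner_commute) simp
  then have "Re (cinner (x - y) (x - y)) = Re (cinner x x) - 2 * Re (cinner x y) + Re (cinner y y)"
    by (simp add: cinner_diff_left cinner_diff_right)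
  then show ?thesis
    by (simp add: cinner_self)
qed

lemma norm_scaleC: "norm (c *\<^sub>C (x::'a::complex_hilbert)) = cmod c * norm x"
proof -
  have "cinner (c *\<^sub>C x) (c *\<^sub>C x) = (c * cnj c) * cinner x x"
    by (simp add: cinner_scaleC_left cinner_scaleC_right)
  also have "\<dots> = complex_of_real ((cmod c * norm x)\<^sup>2)"
    by (simp add: cinner_self power_mult_distrib flip: complex_norm_square)
  finally have "(norm (c *\<^sub>C x))\<^sup>2 = (cmod c * norm x)\<^sup>2"
    by (simp only: cinner_self of_real_eq_iff)
  then show ?thesis
    by (simp add: power2_eq_iff_nonneg)
qed

lemma cinner_cauchy_schwarz: "cmod (cinner x y) \<le> norm x * norm (y::'a::complex_hilbert)"
proof (cases "y = 0")
  case False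
  \<comment> \<open>\<open>c *\<^sub>C y\<close> is the orthogonal projection of \<open>x\<close>
    onto the line of \<open>y\<close>; the inequality says that the squared norm of the remainder is
    nonnegative.\<close>
  define c where "c = cinner x y / complex_of_real ((norm y)\<^sup>2)"
  have "cnj c * cinner x y = complex_of_real ((cmod (cinner x y))\<^sup>2 / (norm y)\<^sup>2)"
    by (simp add: c_def mult.commute flip: complex_norm_square)
  then have r: "Re (cinner x (c *\<^sub>C y)) = (cmod (cinner x y))\<^sup>2 / (norm y)\<^sup>2"
    by (simp only: cinner_scaleC_right Re_complex_of_real)
  have n: "(norm (c *\<^sub>C y))\<^sup>2 = (cmod (cinner x y))\<^sup>2 / (norm y)\<^sup>2"
  proof -
    have "cmod c = cmod (cinner x y) / (norm y)\<^sup>2"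
      by (simp add: c_def norm_divide norm_power)
    then show ?thesis
      using False by (simp add: norm_scaleC field_simps power2_eq_square)
  qed
  have "0 \<le> (norm x)\<^sup>2 - (cmod (cinner x y))\<^sup>2 / (norm y)\<^sup>2"
    using zero_le_power2[of "norm (x - c *\<^sub>C y)"] unfolding norm_diff_sq r n by simp
  then have "(cmod (cinner x y))\<^sup>2 \<le> (norm x * norm y)\<^sup>2"
    using False by (simp add: divide_simps power_mult_distrib)
  then show ?thesis
    by (rule power2_le_imp_le) simp
qed simp

lemma bounded_linear_scaleC_right: "bounded_linear (\<lambda>x. c *\<^sub>C (x::'a::complex_hilbert))"
  by (rule bounded_linear_intro[where K = "cmod c"])
     (simp_all add: scaleC_add_right scaleR_scaleC scaleC_scaleC norm_scaleC mult.commute)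

lemma bounded_linear_cinner_left: "bounded_linear (\<lambda>x. cinner x (y::'a::complex_hilbert))"
  by (rule bounded_linear_intro[where K = "norm y"])
     (simp_all add: cinner_add_left scaleR_scaleC cinner_scaleC_left cinner_cauchy_schwarz
       scaleR_conv_of_real)

section \<open>Bounded complex-linear operators\<close>

lemma bounded_clinear_linear: "bounded_clinear T \<Longrightarrow> bounded_linear T"
  by (simp add: bounded_clinear_def)

lemma bounded_clinear_compose:
  "bounded_clinear S \<Longrightarrow> bounded_clinear T \<Longrightarrow> bounded_clinear (\<lambda>x. S (T x))"
  by (auto simp: bounded_clinear_def intro: bounded_linear_compose)

lemma bounded_clinear_diff:
  "bounded_clinear S \<Longrightarrow> bounded_clinear T \<Longrightarrow> bounded_clinear (\<lambda>x. S x - T x)"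
  by (auto simp: bounded_clinear_def scaleC_diff_right intro: bounded_linear_sub)

lemma bounded_clinear_minus: "bounded_clinear T \<Longrightarrow> bounded_clinear (\<lambda>x. - T x)"
  by (auto simp: bounded_clinear_def intro: bounded_linear_minus)

lemma bounded_clinear_funpow: "bounded_clinear T \<Longrightarrow> bounded_clinear (T ^^ k)"
proof (induction k)
  case 0
  then show ?case
    by (simp add: bounded_clinear_def id_def bounded_linear_ident)
next
  case (Suc k)
  then show ?case
    using bounded_clinear_compose[of T "T ^^ k"] by (simp add: comp_def)
qed

section \<open>Operators bounded below: inverses and small perturbations\<close>

lemma norm_inv_le:
  fixes T :: "'a::real_normed_vector \<Rightarrow> 'a"
  assumes "surj T" and "0 < \<alpha>" and "\<And>x. \<alpha> * norm x \<le> norm (T x)"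
  shows "norm (inv T y) \<le> 1 / \<alpha> * norm y"
  using assms(3)[of "inv T y"] assms(1,2) by (simp add: surj_f_inv_f field_simps)

text \<open>Linearity is transported through the bijection, and the lower bound of \<open>T\<close>
  evaluated at \<open>inv T y\<close> is an upper bound for the inverse.\<close>

lemma bounded_clinear_inv:
  assumes T: "bounded_clinear T" and "bij T" and "0 < \<alpha>"
    and "\<And>x. \<alpha> * norm x \<le> norm (T x)"
  shows "bounded_clinear (inv T)"
proof -
  have [simp]: "T (inv T y) = y" "inv T (T y) = y" for y
    using \<open>bij T\<close> by (simp_all add: bij_is_surj surj_f_inv_f bij_is_inj)
  have lin: "bounded_linear T" and sc: "\<And>c x. T (c *\<^sub>C x) = c *\<^sub>C T x"
    using T by (simp_all add: bounded_clinear_def)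
  interpret bounded_linear T by (fact lin)
  have sc': "inv T (c *\<^sub>C y) = c *\<^sub>C inv T y" for c y
    using sc[of c "inv T y"] by (metis \<open>\<And>y. T (inv T y) = y\<close> \<open>\<And>y. inv T (T y) = y\<close>)
  have "inv T (x + y) = inv T x + inv T y" for x y
    using add[of "inv T x" "inv T y"]
    by (metis \<open>\<And>y. T (inv T y) = y\<close> \<open>\<And>y. inv T (T y) = y\<close>)
  moreover have "norm (inv T y) \<le> norm y * (1 / \<alpha>)" for y
    using norm_inv_le[of T \<alpha> y] assms(2-4) by (simp add: bij_is_surj)
  ultimately have "bounded_linear (inv T)"
    by (intro bounded_linear_intro[where K = "1 / \<alpha>"]) (simp_all add: scaleR_scaleC sc')
  with sc' show ?thesis
    by (simp add: bounded_clinear_def)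
qed

text \<open>Reverse triangle inequality. The constant \<open>\<alpha> - \<mu>\<close> later becomes
  the denominator in the upper bound for the inverse and enters the lower frame bound of
  \<open>\<Psi>\<close>.\<close>

lemma perturbation_lower_bound:
  fixes S M :: "'a::real_normed_vector \<Rightarrow> 'a"
  assumes "\<And>x. \<alpha> * norm x \<le> norm (S x)" and "\<And>x. norm (S x - M x) \<le> \<mu> * norm x"
  shows "(\<alpha> - \<mu>) * norm x \<le> norm (M x)"
  using assms(1,2)[of x] norm_triangle_sub[of "S x" "M x"] by (simp add: algebra_simps)

text \<open>Injectivity is the lower bound \<open>\<alpha> - \<mu> > 0\<close>. For surjectivity,
  \<open>M x = y\<close> is rewritten as the fixed point equation
  \<open>x = inv S (y + (S x - M x))\<close>, whose right-hand side contracts by the factor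
  \<open>\<mu> / \<alpha>\<close>. It is applied twice: with the identity as \<open>S\<close> to
  show that coercive operators are bijective, and with the frame operator as \<open>S\<close> to
  treat the multipliers.\<close>

lemma bij_bounded_below_perturbation:
  fixes S M :: "'a::banach \<Rightarrow> 'a"
  assumes S: "linear S" "bij S" and M: "linear M"
    and low: "\<And>x. \<alpha> * norm x \<le> norm (S x)"
    and close: "\<And>x. norm (S x - M x) \<le> \<mu> * norm x"
    and "0 \<le> \<mu>" "\<mu> < \<alpha>"
  shows "bij M"
proof (rule bijI)
  have pos: "0 < \<alpha>" using \<open>0 \<le> \<mu>\<close> \<open>\<mu> < \<alpha>\<close> by simp
  show "inj M"
  proof (rule injI)
    fix x y assume "M x = M y"
    then have "M (x - y) = 0" by (simp add: linear_diff[OF M])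
    then have "(\<alpha> - \<mu>) * norm (x - y) \<le> 0"
      using perturbation_lower_bound[of \<alpha> S M \<mu>, OF low close, of "x - y"] by simp
    then show "x = y"
      using \<open>\<mu> < \<alpha>\<close> by (simp add: mult_le_0_iff)
  qed
  show "surj M"
  proof (rule surjI)
    fix y
    define G where "G x = inv S (y + (S x - M x))" for x
    have SG: "S (G x) = y + (S x - M x)" for x
      by (simp add: G_def S bij_is_surj surj_f_inv_f)
    have "dist (G u) (G v) \<le> (\<mu> / \<alpha>) * dist u v" for u v
    proof -
      have "\<alpha> * norm (G u - G v) \<le> norm (S (G u - G v))" by (rule low)
      also have "S (G u - G v) = S (u - v) - M (u - v)"
        by (simp add: linear_diff[OF S(1)] linear_diff[OF M] SG)
      also have "norm \<dots> \<le> \<mu> * norm (u - v)" by (rule close)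
      finally show ?thesis
        using pos by (simp add: dist_norm field_simps)
    qed
    then have "\<exists>!x. G x = x"
      using \<open>0 \<le> \<mu>\<close> \<open>\<mu> < \<alpha>\<close> by (intro banach_fix_type[of "\<mu> / \<alpha>"]) auto
    then obtain x where "G x = x" by auto
    then have "M x = y" using SG[of x] by simp
    \<comment> \<open>\<open>surjI\<close> asks for a right inverse of \<open>M\<close>; choosing a
      preimage of each \<open>y\<close> supplies it.\<close>
    then show "M (SOME x. M x = y) = y" by (rule someI)
  qed
qed

section \<open>Coercive operators\<close>

lemma coercive_bounded_below:
  assumes "\<And>x. \<alpha> * (norm x)\<^sup>2 \<le> Re (cinner (S x) (x::'a::complex_hilbert))"
  shows "\<alpha> * norm x \<le> norm (S x)"
proof (cases "x = 0")
  case False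
  \<comment> \<open>Cauchy-Schwarz bounds the quadratic form from above; one factor
    \<open>norm x\<close> then cancels.\<close>
  have "\<alpha> * (norm x)\<^sup>2 \<le> norm (S x) * norm x"
    using assms[of x] complex_Re_le_cmod[of "cinner (S x) x"] cinner_cauchy_schwarz[of "S x" x]
    by linarith
  then have "(\<alpha> * norm x) * norm x \<le> norm (S x) * norm x"
    by (simp only: power2_eq_square mult.assoc)
  then show ?thesis
    using False by (simp only: mult_le_cancel_right_pos zero_less_norm_iff not_False_eq_True)
qed simp

text \<open>
  The Lax--Milgram argument: for \<open>t = \<alpha> / \<beta>\<^sup>2\<close>, coercivity gives \<open>\<parallel>x - t S x\<parallel>\<^sup>2 \<le> (1 - \<alpha>\<^sup>2/\<beta>\<^sup>2) \<parallel>x\<parallel>\<^sup>2\<close>,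
  so \<open>t S\<close> is a small perturbation of the identity.
\<close>

lemma coercive_bij:
  fixes S :: "'a::complex_hilbert \<Rightarrow> 'a"
  assumes S: "bounded_linear S" and "0 < \<alpha>"
    and coercive: "\<And>x. \<alpha> * (norm x)\<^sup>2 \<le> Re (cinner (S x) x)"
  shows "bij S"
proof -
  interpret bounded_linear S by (fact S)
  obtain K where "0 \<le> K" and K: "\<And>x. norm (S x) \<le> norm x * K"
    using nonneg_bounded by blast
  \<comment> \<open>Adding \<open>\<alpha>\<close> to the operator bound makes
    \<open>\<beta>\<close> positive and at least \<open>\<alpha>\<close>, so that \<open>q\<close>
    below lies in \<open>[0, 1)\<close>.\<close>
  define \<beta> where "\<beta> = K + \<alpha>"
  have "0 < \<beta>" "\<alpha> \<le> \<beta>" using \<open>0 \<le> K\<close> \<open>0 < \<alpha>\<close> by (simp_all add: \<beta>_def)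
  have \<beta>: "norm (S x) \<le> \<beta> * norm x" for x
    using K[of x] \<open>0 < \<alpha>\<close> by (simp add: \<beta>_def algebra_simps add_increasing2)
  define t where "t = \<alpha> / \<beta>\<^sup>2"
  define q where "q = 1 - \<alpha>\<^sup>2 / \<beta>\<^sup>2"
  have "0 < t" using \<open>0 < \<alpha>\<close> \<open>0 < \<beta>\<close> by (simp add: t_def)
  have q: "0 \<le> q" "q < 1"
    using \<open>0 < \<alpha>\<close> \<open>0 < \<beta>\<close> \<open>\<alpha> \<le> \<beta>\<close> by (simp_all add: q_def)
  have "norm (x - t *\<^sub>R S x) \<le> sqrt q * norm x" for x
  proof -
    have "Re (cinner x (S x)) = Re (cinner (S x) x)"
      by (subst cinner_commute) simp
    then have "(norm (x - t *\<^sub>R S x))\<^sup>2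
        = (norm x)\<^sup>2 - 2 * t * Re (cinner (S x) x) + t\<^sup>2 * (norm (S x))\<^sup>2"
      by (simp add: norm_diff_sq scaleR_scaleC cinner_scaleC_right norm_scaleC power_mult_distrib)
    also have "\<dots> \<le> (norm x)\<^sup>2 - 2 * t * (\<alpha> * (norm x)\<^sup>2) + t\<^sup>2 * (\<beta> * norm x)\<^sup>2"
      using coercive[of x] \<beta>[of x] \<open>0 < t\<close>
      by (intro add_mono diff_mono mult_left_mono power_mono) auto
    also have "\<dots> = q * (norm x)\<^sup>2"
      using \<open>0 < \<beta>\<close> by (simp add: t_def q_def power2_eq_square field_simps)
    finally have "(norm (x - t *\<^sub>R S x))\<^sup>2 \<le> (sqrt q * norm x)\<^sup>2"
      using q by (simp add: power_mult_distrib)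
    then show ?thesis
      by (rule power2_le_imp_le) (simp add: q)
  qed
  moreover have "linear (\<lambda>x. t *\<^sub>R S x)"
    by (rule linear_compose_scale_right[OF bounded_linear.linear[OF S]])
  \<comment> \<open>The identity is bounded below with constant 1, and \<open>sqrt q < 1\<close>
    measures the perturbation.\<close>
  ultimately have bij: "bij (\<lambda>x. t *\<^sub>R S x)"
    using q by (intro bij_bounded_below_perturbation[OF linear_id bij_id, of _ 1 "sqrt q"]) simp_all
  have "bij (\<lambda>x::'a. (1 / t) *\<^sub>R x)"
    by (rule o_bij[where g = "\<lambda>x. t *\<^sub>R x"]) (use \<open>0 < t\<close> in \<open>simp_all add: fun_eq_iff\<close>)
  with bij have "bij ((\<lambda>x. (1 / t) *\<^sub>R x) \<circ> (\<lambda>x. t *\<^sub>R S x))"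
    by (rule bij_comp)
  also have "(\<lambda>x. (1 / t) *\<^sub>R x) \<circ> (\<lambda>x. t *\<^sub>R S x) = S"
    using \<open>0 < t\<close> by (simp add: fun_eq_iff)
  finally show ?thesis .
qed

section \<open>Neumann series in operator norm\<close>

text \<open>
  With \<open>K = S\<^sup>-\<^sup>1 (S - M)\<close> one has \<open>S\<^sup>-\<^sup>1 = (I - K) M\<^sup>-\<^sup>1\<close>, so the partial sums telescope to
  \<open>M\<^sup>-\<^sup>1 - K\<^sup>N M\<^sup>-\<^sup>1\<close>.
\<close>

lemma neumann_series_op_sums:
  fixes S M :: "'a::complex_hilbert \<Rightarrow> 'a"
  assumes S: "bounded_clinear S" "bij S" and M: "bounded_clinear M" "bij M"
    and low: "\<And>x. \<alpha> * norm x \<le> norm (S x)"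
    and close: "\<And>x. norm (S x - M x) \<le> \<mu> * norm x"
    and "0 \<le> \<mu>" "\<mu> < \<alpha>"
  shows "op_sums (\<lambda>k. ((\<lambda>h. inv S (S h - M h)) ^^ k) \<circ> inv S) (inv M)"
proof -
  define K where "K h = inv S (S h - M h)" for h
  have pos: "0 < \<alpha>" using \<open>0 \<le> \<mu>\<close> \<open>\<mu> < \<alpha>\<close> by simp
  have iS: "bounded_clinear (inv S)"
    using S pos low by (rule bounded_clinear_inv)
  have lowM: "(\<alpha> - \<mu>) * norm x \<le> norm (M x)" for x
    using low close by (rule perturbation_lower_bound)
  have iM: "bounded_clinear (inv M)"
    using M \<open>\<mu> < \<alpha>\<close> lowM by (intro bounded_clinear_inv[of M "\<alpha> - \<mu>"]) simp_all
  have K: "bounded_clinear K"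
    unfolding K_def by (intro bounded_clinear_compose[OF iS] bounded_clinear_diff S M)
  have F: "bounded_clinear ((K ^^ k) \<circ> inv S)" for k
    using bounded_clinear_compose[OF bounded_clinear_funpow[OF K] iS] by (simp add: comp_def)
  \<comment> \<open>The ratio of the geometric series: \<open>S - M\<close> contributes
    \<open>\<mu>\<close> and \<open>inv S\<close> contributes \<open>1 / \<alpha>\<close>.\<close>
  define q where "q = \<mu> / \<alpha>"
  have q: "0 \<le> q" "q < 1" using pos \<open>0 \<le> \<mu>\<close> \<open>\<mu> < \<alpha>\<close> by (simp_all add: q_def)
  have nK: "norm (K h) \<le> q * norm h" for h
  proof -
    have "norm (K h) \<le> 1 / \<alpha> * norm (S h - M h)"
      unfolding K_def using S(2) pos low by (intro norm_inv_le) (simp_all add: bij_is_surj)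
    also have "\<dots> \<le> 1 / \<alpha> * (\<mu> * norm h)"
      using pos close by (intro mult_left_mono) auto
    finally show ?thesis by (simp add: q_def)
  qed
  have nKk: "norm ((K ^^ k) h) \<le> q ^ k * norm h" for k h
  proof (induction k)
    case (Suc k)
    have "norm ((K ^^ Suc k) h) \<le> q * norm ((K ^^ k) h)" by (simp add: nK)
    also have "\<dots> \<le> q * (q ^ k * norm h)" using Suc q by (intro mult_left_mono)
    finally show ?case by (simp add: mult.assoc)
  qed simp
  have [simp]: "S (inv S y) = y" "inv S (S y) = y" "M (inv M y) = y" for y
    using S(2) M(2) by (simp_all add: bij_is_surj surj_f_inv_f bij_is_inj)
  have telescope: "(\<Sum>k<N. ((K ^^ k) \<circ> inv S) h) - inv M h = - (K ^^ N) (inv M h)" for N h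
  proof (induction N)
    case (Suc N)
    have "inv S h = inv M h - K (inv M h)"
      using linear_diff[OF bounded_linear.linear[OF bounded_clinear_linear[OF iS]],
          of "S (inv M h)" h]
      by (simp add: K_def)
    then have "(K ^^ N) (inv S h) = (K ^^ N) (inv M h) - (K ^^ N) (K (inv M h))"
      by (metis linear_diff bounded_linear.linear bounded_clinear_linear
          bounded_clinear_funpow[OF K])
    then have "(\<Sum>k<Suc N. ((K ^^ k) \<circ> inv S) h) - inv M h
        = ((\<Sum>k<N. ((K ^^ k) \<circ> inv S) h) - inv M h) + ((K ^^ N) (inv M h) - (K ^^ N) (K (inv M h)))"
      by simp
    also have "\<dots> = - (K ^^ N) (K (inv M h))"
      unfolding Suc by simp
    finally show ?case by (simp add: funpow_swap1)
  qed simp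
  have "(\<lambda>N. onorm (\<lambda>h. (\<Sum>k<N. ((K ^^ k) \<circ> inv S) h) - inv M h)) \<longlonglongrightarrow> 0"
  proof (rule Lim_null_comparison)
    show "(\<lambda>N. q ^ N * (1 / (\<alpha> - \<mu>))) \<longlonglongrightarrow> 0"
      using q by (intro tendsto_mult_left_zero LIMSEQ_realpow_zero)
    \<comment> \<open>After telescoping, the remainder is an operator of norm at most
      \<open>q ^ N / (\<alpha> - \<mu>)\<close>; nonnegativity removes the absolute value in the
      comparison with this null sequence.\<close>
    have "0 \<le> onorm (\<lambda>h. - (K ^^ N) (inv M h))
        \<and> onorm (\<lambda>h. - (K ^^ N) (inv M h)) \<le> q ^ N * (1 / (\<alpha> - \<mu>))" for N
    proof
      have "bounded_clinear (\<lambda>h. - (K ^^ N) (inv M h))"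
        by (intro bounded_clinear_minus bounded_clinear_compose[OF bounded_clinear_funpow[OF K] iM])
      then show "0 \<le> onorm (\<lambda>h. - (K ^^ N) (inv M h))"
        by (intro onorm_pos_le bounded_clinear_linear)
      show "onorm (\<lambda>h. - (K ^^ N) (inv M h)) \<le> q ^ N * (1 / (\<alpha> - \<mu>))"
      proof (rule onorm_bound)
        fix h
        have "norm (inv M h) \<le> 1 / (\<alpha> - \<mu>) * norm h"
          using M(2) \<open>\<mu> < \<alpha>\<close> lowM by (intro norm_inv_le) (simp_all add: bij_is_surj)
        then have "q ^ N * norm (inv M h) \<le> q ^ N * (1 / (\<alpha> - \<mu>) * norm h)"
          using q by (intro mult_left_mono) auto
        then show "norm (- (K ^^ N) (inv M h)) \<le> q ^ N * (1 / (\<alpha> - \<mu>)) * norm h"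
          using nKk[of N "inv M h"] by simp
      qed (use q \<open>\<mu> < \<alpha>\<close> in simp)
    qed
    then show "\<forall>\<^sub>F N in sequentially. norm (onorm (\<lambda>h. (\<Sum>k<N. ((K ^^ k) \<circ> inv S) h) - inv M h))
        \<le> q ^ N * (1 / (\<alpha> - \<mu>))"
      unfolding telescope by simp
  qed
  moreover have "(\<lambda>h. inv S (S h - M h)) = K" by (simp add: fun_eq_iff K_def)
  ultimately show ?thesis
    using F iM by (simp add: op_sums_def)
qed

section \<open>Bessel sequences and synthesis\<close>

text \<open>Duality: pairing the sum \<open>x\<close> with itself and applying Cauchy-Schwarz to the
  coefficients leaves the analysis coefficients of \<open>x\<close>, which the Bessel bound controls
  by \<open>sqrt B * norm x\<close>. One factor \<open>norm x\<close> cancels.\<close>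

lemma bessel_finite_synthesis:
  assumes "bessel_bound \<Phi> B" and "finite I"
  shows "norm (\<Sum>n\<in>I. c n *\<^sub>C \<Phi> n) \<le> sqrt (B * (\<Sum>n\<in>I. (cmod (c n))\<^sup>2))"
proof -
  define x where "x = (\<Sum>n\<in>I. c n *\<^sub>C \<Phi> n)"
  define s where "s = (\<Sum>n\<in>I. (cmod (c n))\<^sup>2)"
  have "0 \<le> s" by (simp add: s_def sum_nonneg)
  have "0 < B" using assms by (simp add: bessel_bound_def)
  have "(norm x)\<^sup>2 = cmod (cinner x x)"
    by (simp add: cinner_self norm_power)
  also have "\<dots> = cmod (\<Sum>n\<in>I. c n * cinner (\<Phi> n) x)"
    \<comment> \<open>Only the first argument is expanded; the second \<open>x\<close> stays as the
      vector to which the Bessel bound is applied.\<close>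
    by (subst (1) x_def) (simp add: cinner_sum_left cinner_scaleC_left)
  also have "\<dots> \<le> (\<Sum>n\<in>I. cmod (c n) * cmod (cinner x (\<Phi> n)))"
    by (rule order_trans[OF norm_sum])
       (metis (no_types, lifting) cinner_commute complex_mod_cnj norm_mult order_refl sum.cong)
  also have "\<dots> \<le> L2_set (\<lambda>n. cmod (c n)) I * L2_set (\<lambda>n. cmod (cinner x (\<Phi> n))) I"
    using L2_set_mult_ineq[of "\<lambda>n. cmod (c n)" "\<lambda>n. cmod (cinner x (\<Phi> n))" I] by simp
  also have "\<dots> \<le> sqrt s * sqrt (B * (norm x)\<^sup>2)"
  proof -
    have "(\<Sum>n\<in>I. (cmod (cinner x (\<Phi> n)))\<^sup>2) \<le> (\<Sum>n. (cmod (cinner x (\<Phi> n)))\<^sup>2)"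
      using assms by (intro sum_le_suminf) (auto simp: bessel_bound_def)
    also have "\<dots> \<le> B * (norm x)\<^sup>2"
      using assms by (simp add: bessel_bound_def)
    finally show ?thesis
      unfolding L2_set_def s_def by (intro mult_left_mono real_sqrt_le_mono) (simp_all add: sum_nonneg)
  qed
  also have "\<dots> = sqrt (B * s) * norm x"
    by (simp add: real_sqrt_mult)
  finally have "norm x * norm x \<le> sqrt (B * s) * norm x"
    by (simp add: power2_eq_square)
  then have "norm x \<le> sqrt (B * s)"
    using \<open>0 \<le> s\<close> \<open>0 < B\<close> by (cases "x = 0") simp_all
  then show ?thesis by (simp add: x_def s_def)
qed

text \<open>The finite estimate on the blocks \<open>{m..<n}\<close> carries the Cauchy criterion
  from the squared coefficients to the vectors, and on initial segments it passes to the
  limit.\<close>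

lemma bessel_synthesis:
  assumes \<Phi>: "bessel_bound \<Phi> B" and c: "summable (\<lambda>n. (cmod (c n))\<^sup>2)"
  shows "summable (\<lambda>n. c n *\<^sub>C \<Phi> n)"
    and "norm (\<Sum>n. c n *\<^sub>C \<Phi> n) \<le> sqrt (B * (\<Sum>n. (cmod (c n))\<^sup>2))"
proof -
  have "0 < B" using \<Phi> by (simp add: bessel_bound_def)
  show s: "summable (\<lambda>n. c n *\<^sub>C \<Phi> n)"
    unfolding summable_Cauchy
  proof (intro allI impI)
    fix e :: real assume "0 < e"
    \<comment> \<open>This tolerance is chosen so that the block estimate, the square root of
      \<open>B\<close> times the tail, falls below \<open>e\<close>.\<close>
    then have "0 < e\<^sup>2 / B" using \<open>0 < B\<close> by simp
    then obtain N where N: "\<And>m n. N \<le> m \<Longrightarrow> norm (\<Sum>k=m..<n. (cmod (c k))\<^sup>2) < e\<^sup>2 / B"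
      using c unfolding summable_Cauchy by blast
    have "norm (\<Sum>k=m..<n. c k *\<^sub>C \<Phi> k) < e" if "N \<le> m" for m n
    proof -
      have "B * (\<Sum>k=m..<n. (cmod (c k))\<^sup>2) < e\<^sup>2"
        using N[OF that, of n] \<open>0 < B\<close> by (simp add: field_simps sum_nonneg)
      then have "sqrt (B * (\<Sum>k=m..<n. (cmod (c k))\<^sup>2)) < e"
        using \<open>0 < e\<close> by (simp add: real_less_lsqrt)
      then show ?thesis
        using bessel_finite_synthesis[OF \<Phi>, of "{m..<n}" c] by simp
    qed
    then show "\<exists>N. \<forall>m\<ge>N. \<forall>n. norm (\<Sum>k=m..<n. c k *\<^sub>C \<Phi> k) < e" by blast
  qed
  have "(\<lambda>N. norm (\<Sum>n<N. c n *\<^sub>C \<Phi> n)) \<longlonglongrightarrow> norm (\<Sum>n. c n *\<^sub>C \<Phi> n)"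
    by (intro tendsto_norm summable_LIMSEQ s)
  moreover have "norm (\<Sum>n<N. c n *\<^sub>C \<Phi> n) \<le> sqrt (B * (\<Sum>n. (cmod (c n))\<^sup>2))" for N
  proof -
    have "(\<Sum>n<N. (cmod (c n))\<^sup>2) \<le> (\<Sum>n. (cmod (c n))\<^sup>2)"
      using c by (intro sum_le_suminf) auto
    then have "sqrt (B * (\<Sum>n<N. (cmod (c n))\<^sup>2)) \<le> sqrt (B * (\<Sum>n. (cmod (c n))\<^sup>2))"
      using \<open>0 < B\<close> by (intro real_sqrt_le_mono mult_left_mono) auto
    then show ?thesis
      using bessel_finite_synthesis[OF \<Phi>, of "{..<N}" c] by (meson finite_lessThan order_trans)
  qed
  ultimately show "norm (\<Sum>n. c n *\<^sub>C \<Phi> n) \<le> sqrt (B * (\<Sum>n. (cmod (c n))\<^sup>2))"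
    by (intro LIMSEQ_le_const2) blast+
qed

lemma bessel_bound_uminus: "bessel_bound (\<lambda>n. - \<Phi> n) B \<longleftrightarrow> bessel_bound \<Phi> B"
  by (simp add: bessel_bound_def)

text \<open>Termwise \<open>(u + v)\<^sup>2 \<le> 2 * u\<^sup>2 + 2 * v\<^sup>2\<close>. The
  constant is crude; writing \<open>\<Psi>\<close> as \<open>\<Phi>\<close> plus the difference, it
  serves for qualitative facts: convergence, boundedness and some upper frame bound.\<close>

lemma bessel_bound_add:
  assumes "bessel_bound \<Phi> B" and "bessel_bound \<Psi> C"
  shows "bessel_bound (\<lambda>n. \<Phi> n + \<Psi> n) (2 * B + 2 * C)"
  unfolding bessel_bound_def
proof (intro conjI allI)
  show "0 < 2 * B + 2 * C" using assms by (simp add: bessel_bound_def)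
  fix h
  let ?p = "\<lambda>n. (cmod (cinner h (\<Phi> n)))\<^sup>2" and ?q = "\<lambda>n. (cmod (cinner h (\<Psi> n)))\<^sup>2"
    and ?r = "\<lambda>n. (cmod (cinner h (\<Phi> n + \<Psi> n)))\<^sup>2"
  have s: "summable ?p" "summable ?q"
    and b: "suminf ?p \<le> B * (norm h)\<^sup>2" "suminf ?q \<le> C * (norm h)\<^sup>2"
    using assms by (simp_all add: bessel_bound_def)
  have le: "?r n \<le> 2 * ?p n + 2 * ?q n" for n
  proof -
    have "?r n \<le> (cmod (cinner h (\<Phi> n)) + cmod (cinner h (\<Psi> n)))\<^sup>2"
      by (intro power_mono) (simp_all add: cinner_add_right norm_triangle_ineq)
    also have "\<dots> \<le> 2 * ?p n + 2 * ?q n"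
      using sum_squares_bound[of "cmod (cinner h (\<Phi> n))" "cmod (cinner h (\<Psi> n))"]
      by (simp add: power2_sum)
    finally show ?thesis .
  qed
  have s2: "summable (\<lambda>n. 2 * ?p n + 2 * ?q n)"
    by (intro summable_add summable_mult s)
  show s3: "summable ?r"
    using le by (intro summable_comparison_test'[OF s2, of 0]) simp
  have "suminf ?r \<le> (\<Sum>n. 2 * ?p n + 2 * ?q n)"
    by (intro suminf_le le s2 s3)
  also have "\<dots> = 2 * suminf ?p + 2 * suminf ?q"
    using s by (simp add: suminf_add[symmetric] suminf_mult summable_mult)
  also have "\<dots> \<le> (2 * B + 2 * C) * (norm h)\<^sup>2"
    using b by (simp add: algebra_simps)
  finally show "suminf ?r \<le> (2 * B + 2 * C) * (norm h)\<^sup>2" .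
qed

section \<open>Multipliers with bounded symbol\<close>

text \<open>A bounded symbol keeps the analysis coefficients square summable, which exhibits a
  multiplier as the synthesis of a square summable sequence.\<close>

lemma multiplier_coefficients:
  assumes \<Psi>: "bessel_bound \<Psi> C" and m: "\<And>n. cmod (m n) \<le> b"
  shows "summable (\<lambda>n. (cmod (m n * cinner f (\<Psi> n)))\<^sup>2)"
    and "(\<Sum>n. (cmod (m n * cinner f (\<Psi> n)))\<^sup>2) \<le> b\<^sup>2 * (\<Sum>n. (cmod (cinner f (\<Psi> n)))\<^sup>2)"
proof -
  have le: "(cmod (m n * cinner f (\<Psi> n)))\<^sup>2 \<le> b\<^sup>2 * (cmod (cinner f (\<Psi> n)))\<^sup>2" for n
    using m[of n] by (simp add: norm_mult power_mult_distrib mult_right_mono power_mono)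
  have s: "summable (\<lambda>n. (cmod (cinner f (\<Psi> n)))\<^sup>2)"
    using \<Psi> by (simp add: bessel_bound_def)
  have s2: "summable (\<lambda>n. b\<^sup>2 * (cmod (cinner f (\<Psi> n)))\<^sup>2)"
    by (intro summable_mult s)
  show s3: "summable (\<lambda>n. (cmod (m n * cinner f (\<Psi> n)))\<^sup>2)"
    using le by (intro summable_comparison_test'[OF s2, of 0]) simp
  show "(\<Sum>n. (cmod (m n * cinner f (\<Psi> n)))\<^sup>2) \<le> b\<^sup>2 * (\<Sum>n. (cmod (cinner f (\<Psi> n)))\<^sup>2)"
    using suminf_le[OF le s3 s2] s by (simp add: suminf_mult)
qed

lemma multiplier_summable:
  assumes "bessel_bound \<Phi> B" and "bessel_bound \<Psi> C" and "\<And>n. cmod (m n) \<le> b"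
  shows "summable (\<lambda>n. m n *\<^sub>C cinner f (\<Psi> n) *\<^sub>C \<Phi> n)"
  using bessel_synthesis(1)[OF assms(1) multiplier_coefficients(1)[OF assms(2,3)]]
  by (simp add: scaleC_scaleC)

text \<open>The coefficient sum is kept instead of being replaced by
  \<open>C * (norm f)\<^sup>2\<close>: this form turns a lower bound for the multiplier into a lower
  frame bound for \<open>\<Psi>\<close>.\<close>

lemma norm_multiplier_le_coefficients:
  assumes \<Phi>: "bessel_bound \<Phi> B" and \<Psi>: "bessel_bound \<Psi> C" and m: "\<And>n. cmod (m n) \<le> b"
  shows "norm (multiplier m \<Phi> \<Psi> f) \<le> b * sqrt (B * (\<Sum>n. (cmod (cinner f (\<Psi> n)))\<^sup>2))"
proof -
  have "0 < B" using \<Phi> by (simp add: bessel_bound_def)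
  have "0 \<le> b" using m[of 0] norm_ge_zero[of "m 0"] by linarith
  have "norm (multiplier m \<Phi> \<Psi> f) \<le> sqrt (B * (\<Sum>n. (cmod (m n * cinner f (\<Psi> n)))\<^sup>2))"
    using bessel_synthesis(2)[OF \<Phi> multiplier_coefficients(1)[OF \<Psi> m]]
    by (simp add: multiplier_def scaleC_scaleC)
  also have "\<dots> \<le> sqrt (B * (b\<^sup>2 * (\<Sum>n. (cmod (cinner f (\<Psi> n)))\<^sup>2)))"
    using \<open>0 < B\<close> multiplier_coefficients(2)[OF \<Psi> m]
    by (intro real_sqrt_le_mono mult_left_mono) auto
  also have "\<dots> = b * sqrt (B * (\<Sum>n. (cmod (cinner f (\<Psi> n)))\<^sup>2))"
    using \<open>0 \<le> b\<close> by (simp add: real_sqrt_mult)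
  finally show ?thesis .
qed

lemma norm_multiplier_le:
  assumes \<Phi>: "bessel_bound \<Phi> B" and \<Psi>: "bessel_bound \<Psi> C" and m: "\<And>n. cmod (m n) \<le> b"
  shows "norm (multiplier m \<Phi> \<Psi> f) \<le> b * sqrt (B * C) * norm f"
proof -
  have "0 < B" using \<Phi> by (simp add: bessel_bound_def)
  have "0 \<le> b" using m[of 0] norm_ge_zero[of "m 0"] by linarith
  have "norm (multiplier m \<Phi> \<Psi> f) \<le> b * sqrt (B * (\<Sum>n. (cmod (cinner f (\<Psi> n)))\<^sup>2))"
    using \<Phi> \<Psi> m by (rule norm_multiplier_le_coefficients)
  also have "\<dots> \<le> b * sqrt (B * (C * (norm f)\<^sup>2))"
    using \<open>0 < B\<close> \<open>0 \<le> b\<close> \<Psi>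
    by (intro mult_left_mono real_sqrt_le_mono) (auto simp: bessel_bound_def)
  finally show ?thesis by (simp add: real_sqrt_mult)
qed

lemma bounded_clinear_multiplier:
  assumes \<Phi>: "bessel_bound \<Phi> B" and \<Psi>: "bessel_bound \<Psi> C" and m: "\<And>n. cmod (m n) \<le> b"
  shows "bounded_clinear (multiplier m \<Phi> \<Psi>)"
proof -
  have s: "summable (\<lambda>n. m n *\<^sub>C cinner f (\<Psi> n) *\<^sub>C \<Phi> n)" for f
    using \<Phi> \<Psi> m by (rule multiplier_summable)
  have sc: "multiplier m \<Phi> \<Psi> (c *\<^sub>C x) = c *\<^sub>C multiplier m \<Phi> \<Psi> x" for c x
    using bounded_linear.suminf[OF bounded_linear_scaleC_right[of c] s[of x]]
    by (simp add: multiplier_def cinner_scaleC_left scaleC_scaleC mult_ac)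
  have "multiplier m \<Phi> \<Psi> (x + y) = multiplier m \<Phi> \<Psi> x + multiplier m \<Phi> \<Psi> y" for x y
    using suminf_add[OF s[of x] s[of y]]
    by (simp add: multiplier_def cinner_add_left scaleC_add_left scaleC_add_right)
  then have "bounded_linear (multiplier m \<Phi> \<Psi>)"
    using norm_multiplier_le[OF \<Phi> \<Psi> m]
    by (intro bounded_linear_intro[where K = "b * sqrt (B * C)"])
       (simp_all add: scaleR_scaleC sc mult.commute)
  with sc show ?thesis by (simp add: bounded_clinear_def)
qed

lemma multiplier_diff_right:
  assumes "bessel_bound \<Phi> B" and "bessel_bound \<Psi> C" and "bessel_bound \<Theta> D"
    and "\<And>n. cmod (m n) \<le> b"
  shows "multiplier m \<Phi> \<Psi> f - multiplier m \<Phi> \<Theta> f = multiplier m \<Phi> (\<lambda>n. \<Psi> n - \<Theta> n) f"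
  using suminf_diff[OF multiplier_summable[OF assms(1,2,4), where f = f]
      multiplier_summable[OF assms(1,3,4), where f = f]]
  by (simp add: multiplier_def cinner_diff_right complex_vector.scale_left_diff_distrib
      scaleC_diff_right)

lemma multiplier_diff_left:
  assumes "bessel_bound \<Phi> B" and "bessel_bound \<Psi> C" and "bessel_bound \<Theta> D"
    and "\<And>n. cmod (m n) \<le> b"
  shows "multiplier m \<Psi> \<Phi> f - multiplier m \<Theta> \<Phi> f = multiplier m (\<lambda>n. \<Psi> n - \<Theta> n) \<Phi> f"
  using suminf_diff[OF multiplier_summable[OF assms(2,1,4), where f = f]
      multiplier_summable[OF assms(3,1,4), where f = f]]
  by (simp add: multiplier_def scaleC_diff_right)

lemma multiplier_uminus:
  assumes "\<And>f. summable (\<lambda>n. m n *\<^sub>C cinner f (\<Psi> n) *\<^sub>C \<Phi> n)"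
  shows "multiplier (\<lambda>n. - m n) \<Phi> \<Psi> f = - multiplier m \<Phi> \<Psi> f"
  using suminf_minus[OF assms[of f]] by (simp add: multiplier_def)

section \<open>The weighted frame operator\<close>

text \<open>One factor \<open>sqrt (w n)\<close> comes out of the inner product, where conjugation
  fixes a real scalar, and the other out of the synthesis vector.\<close>

lemma frame_operator_sqrt_weight:
  assumes "\<And>n. 0 \<le> w n"
  shows "frame_operator (\<lambda>n. sqrt (w n) *\<^sub>R \<Phi> n) = multiplier (\<lambda>n. complex_of_real (w n)) \<Phi> \<Phi>"
proof
  fix h
  have "cinner h (sqrt (w n) *\<^sub>R \<Phi> n) *\<^sub>C (sqrt (w n) *\<^sub>R \<Phi> n)
      = complex_of_real (w n) *\<^sub>C cinner h (\<Phi> n) *\<^sub>C \<Phi> n" for n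
  proof -
    have "complex_of_real (sqrt (w n)) * complex_of_real (sqrt (w n)) = complex_of_real (w n)"
      using assms[of n] by (simp flip: of_real_mult)
    then show ?thesis
      by (simp add: scaleR_scaleC cinner_scaleC_right scaleC_scaleC mult.commute mult.left_commute)
  qed
  then show "frame_operator (\<lambda>n. sqrt (w n) *\<^sub>R \<Phi> n) h
      = multiplier (\<lambda>n. complex_of_real (w n)) \<Phi> \<Phi> h"
    by (simp add: frame_operator_def multiplier_def)
qed

text \<open>The quadratic form is the series of \<open>w n\<close> times the squared coefficients,
  so \<open>a \<le> w n\<close> compares it termwise with the lower frame inequality.\<close>

lemma weighted_frame_operator_coercive:
  assumes fr: "frame_bounds \<Phi> A B" and w: "0 < a" "\<And>n. a \<le> w n" "\<And>n. w n \<le> b"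
  shows "a * A * (norm h)\<^sup>2 \<le> Re (cinner (multiplier (\<lambda>n. complex_of_real (w n)) \<Phi> \<Phi> h) h)"
proof -
  have \<Phi>: "bessel_bound \<Phi> B" using fr by (simp add: frame_bounds_def)
  have w0: "0 < w n" for n using w(1) w(2)[of n] by linarith
  then have cw: "cmod (complex_of_real (w n)) \<le> b" for n
    using w(3)[of n] by (simp add: abs_of_pos)
  let ?c = "\<lambda>n. (cmod (cinner h (\<Phi> n)))\<^sup>2"
  have quad: "Re (cinner (complex_of_real (w n) *\<^sub>C cinner h (\<Phi> n) *\<^sub>C \<Phi> n) h) = w n * ?c n" for n
  proof -
    have "cinner (\<Phi> n) h = cnj (cinner h (\<Phi> n))" by (rule cinner_commute)
    then have "cinner h (\<Phi> n) * cinner (\<Phi> n) h = complex_of_real (?c n)"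
      by (simp flip: complex_norm_square)
    then show ?thesis
      by (simp only: cinner_scaleC_left) (simp only: Re_complex_of_real flip: of_real_mult)
  qed
  \<comment> \<open>Continuity of this functional allows it to be applied to the series term by
    term.\<close>
  have "bounded_linear (\<lambda>x. Re (cinner x h))"
    by (rule bounded_linear_compose[OF bounded_linear_Re bounded_linear_cinner_left])
  moreover have "summable (\<lambda>n. complex_of_real (w n) *\<^sub>C cinner h (\<Phi> n) *\<^sub>C \<Phi> n)"
    using \<Phi> \<Phi> cw by (rule multiplier_summable)
  ultimately have "(\<lambda>n. Re (cinner (complex_of_real (w n) *\<^sub>C cinner h (\<Phi> n) *\<^sub>C \<Phi> n) h)) sums
      Re (cinner (\<Sum>n. complex_of_real (w n) *\<^sub>C cinner h (\<Phi> n) *\<^sub>C \<Phi> n) h)"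
    using bounded_linear.sums summable_sums by blast
  then
  have sums: "(\<lambda>n. w n * ?c n) sums Re (cinner (multiplier (\<lambda>n. complex_of_real (w n)) \<Phi> \<Phi> h) h)"
    by (simp only: quad multiplier_def)
  have s: "summable ?c" using \<Phi> by (simp add: bessel_bound_def)
  have "a * A * (norm h)\<^sup>2 \<le> a * suminf ?c"
    using fr w(1) by (simp add: frame_bounds_def mult.assoc)
  also have "\<dots> = (\<Sum>n. a * ?c n)"
    using s by (simp add: suminf_mult)
  also have "\<dots> \<le> (\<Sum>n. w n * ?c n)"
    using w(2) s sums by (intro suminf_le) (auto simp: mult_right_mono summable_mult sums_iff)
  finally show ?thesis using sums by (simp add: sums_iff)
qed

section \<open>Invertibility and change of sign\<close>

lemma invertible_multiplierI:
  assumes "\<And>f. summable (\<lambda>n. m n *\<^sub>C cinner f (\<Psi> n) *\<^sub>C \<Phi> n)"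
    and "bij (multiplier m \<Phi> \<Psi>)" and "bounded_clinear (inv (multiplier m \<Phi> \<Psi>))"
  shows "invertible_multiplier m \<Phi> \<Psi>"
  unfolding invertible_multiplier_def
  using assms by (auto simp: bij_is_surj surj_f_inv_f bij_is_inj
      intro!: exI[of _ "inv (multiplier m \<Phi> \<Psi>)"])

text \<open>Serves negative symbols, where the multiplier is the negative of the one with symbol
  \<open>\<bar>m n\<bar>\<close>.\<close>

lemma inv_uminus:
  fixes M :: "'a::real_vector \<Rightarrow> 'a"
  assumes "linear M" "bij M"
  shows "bij (\<lambda>h. - M h)" and "inv (\<lambda>h. - M h) = (\<lambda>h. - inv M h)"
proof -
  have [simp]: "M (inv M y) = y" "inv M (M y) = y" for y
    using \<open>bij M\<close> by (simp_all add: bij_is_surj surj_f_inv_f bij_is_inj)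
  have [simp]: "M (- y) = - M y" for y using \<open>linear M\<close> by (rule linear_neg)
  have [simp]: "inv M (- y) = - inv M y" for y
    by (metis \<open>\<And>y. M (inv M y) = y\<close> \<open>\<And>y. inv M (M y) = y\<close> \<open>\<And>y. M (- y) = - M y\<close>)
  show "bij (\<lambda>h. - M h)"
    by (rule o_bij[where g = "\<lambda>h. - inv M h"]) (simp_all add: comp_def id_def)
  show "inv (\<lambda>h. - M h) = (\<lambda>h. - inv M h)"
    by (rule inv_equality) simp_all
qed

section \<open>Assembly for both orders of the sequences and both signs\<close>

theorem proposition4p8:
  fixes \<Phi> \<Psi> :: "nat \<Rightarrow> 'a::complex_hilbert"
    and m :: "nat \<Rightarrow> real"
    and A\<^sub>\<Phi> B\<^sub>\<Phi> B\<^sub>\<Delta> a b :: real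
  assumes separable: "separable_space (euclidean :: 'a topology)"
    and infinite_dim: "cinfinite_dimensional TYPE('a)"
    and frame: "frame_bounds \<Phi> A\<^sub>\<Phi> B\<^sub>\<Phi>"
    and nonzero: "\<And>n. \<Phi> n \<noteq> 0" "\<And>n. \<Psi> n \<noteq> 0"
    and bessel: "bessel_bound (\<lambda>n. \<Psi> n - \<Phi> n) B\<^sub>\<Delta>"
    and bessel_small: "B\<^sub>\<Delta> < A\<^sub>\<Phi>\<^sup>2 / B\<^sub>\<Phi>"
    and sign: "(\<forall>n. 0 < m n) \<or> (\<forall>n. m n < 0)"
    and semi_normalized: "0 < a" "\<And>n. a \<le> \<bar>m n\<bar>" "\<And>n. \<bar>m n\<bar> \<le> b"
    and ratio: "b / a < A\<^sub>\<Phi> / sqrt (B\<^sub>\<Delta> * B\<^sub>\<Phi>)"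
  shows "is_frame \<Psi> \<and>
    invertible_multiplier (\<lambda>n. complex_of_real (m n)) \<Phi> \<Psi> \<and>
    invertible_multiplier (\<lambda>n. complex_of_real (m n)) \<Psi> \<Phi> \<and>
    (\<forall>M \<in> {multiplier (\<lambda>n. complex_of_real (m n)) \<Phi> \<Psi>,
           multiplier (\<lambda>n. complex_of_real (m n)) \<Psi> \<Phi>}.
      (\<forall>h. 1 / (b * B\<^sub>\<Phi> + b * sqrt (B\<^sub>\<Phi> * B\<^sub>\<Delta>)) * norm h \<le> norm (inv M h) \<and>
           norm (inv M h) \<le> 1 / (a * A\<^sub>\<Phi> - b * sqrt (B\<^sub>\<Phi> * B\<^sub>\<Delta>)) * norm h) \<and>
      ((\<forall>n. 0 < m n) \<longrightarrow>
        (let S = frame_operator (\<lambda>n. sqrt (m n) *\<^sub>R \<Phi> n)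
         in op_sums (\<lambda>k. ((\<lambda>h. inv S (S h - M h)) ^^ k) \<circ> inv S) (inv M))) \<and>
      ((\<forall>n. m n < 0) \<longrightarrow>
        (let S = frame_operator (\<lambda>n. sqrt \<bar>m n\<bar> *\<^sub>R \<Phi> n)
         in \<exists>T. op_sums (\<lambda>k. ((\<lambda>h. inv S (S h + M h)) ^^ k) \<circ> inv S) T \<and>
              inv M = (\<lambda>h. - T h))))"
proof -
  define w where "w n = \<bar>m n\<bar>" for n
  define W where "W n = complex_of_real (w n)" for n
  define S where "S = multiplier W \<Phi> \<Phi>"
  define \<mu> where "\<mu> = b * sqrt (B\<^sub>\<Phi> * B\<^sub>\<Delta>)"
  have w: "a \<le> w n" "w n \<le> b" for n using semi_normalized by (simp_all add: w_def)
  have W: "cmod (W n) \<le> b" for n using w(2)[of n] by (simp add: W_def w_def)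
  have "0 < b" using semi_normalized(1) w[of 0] by linarith
  have \<Phi>: "bessel_bound \<Phi> B\<^sub>\<Phi>" and pos: "0 < A\<^sub>\<Phi>" "0 < B\<^sub>\<Phi>" "0 < B\<^sub>\<Delta>"
    using frame bessel by (simp_all add: frame_bounds_def bessel_bound_def)
  \<comment> \<open>The operator differences involve \<open>\<Phi> - \<Psi>\<close>, the hypothesis
    \<open>\<Psi> - \<Phi>\<close>; Bessel bounds ignore the sign.\<close>
  have \<Delta>: "bessel_bound (\<lambda>n. \<Phi> n - \<Psi> n) B\<^sub>\<Delta>"
    using bessel bessel_bound_uminus[of "\<lambda>n. \<Phi> n - \<Psi> n" B\<^sub>\<Delta>] by simp
  define B\<^sub>\<Psi> where "B\<^sub>\<Psi> = 2 * B\<^sub>\<Phi> + 2 * B\<^sub>\<Delta>"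
  have \<Psi>: "bessel_bound \<Psi> B\<^sub>\<Psi>"
    using bessel_bound_add[OF \<Phi> bessel] by (simp add: B\<^sub>\<Psi>_def)
  \<comment> \<open>This is the ratio hypothesis cross-multiplied: the perturbation is smaller than
    the lower bound of \<open>S\<close>.\<close>
  have \<mu>: "0 \<le> \<mu>" "\<mu> < a * A\<^sub>\<Phi>"
    using ratio pos semi_normalized(1) \<open>0 < b\<close> by (simp_all add: \<mu>_def field_simps)

  have S: "bounded_clinear S"
    unfolding S_def using \<Phi> \<Phi> W by (rule bounded_clinear_multiplier)
  have coercive: "a * A\<^sub>\<Phi> * (norm h)\<^sup>2 \<le> Re (cinner (S h) h)" for h
    using weighted_frame_operator_coercive[OF frame semi_normalized(1) w] by (simp add: S_def W_def[abs_def])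
  have bij_S: "bij S"
    using S semi_normalized(1) pos coercive
    by (intro coercive_bij[of S "a * A\<^sub>\<Phi>"]) (simp_all add: bounded_clinear_def)
  have low_S: "a * A\<^sub>\<Phi> * norm h \<le> norm (S h)" for h
    using coercive by (rule coercive_bounded_below)
  have up_S: "norm (S h) \<le> b * B\<^sub>\<Phi> * norm h" for h
    using norm_multiplier_le[OF \<Phi> \<Phi> W, where f = h] pos by (simp add: S_def)

  \<comment> \<open>Collects what is claimed for a multiplier with positive symbol \<open>W\<close>,
    so that one argument from closeness to \<open>S\<close> covers both orders.\<close>
  define good where "good N \<longleftrightarrow> bounded_clinear N \<and> bij N \<and> bounded_clinear (inv N)
      \<and> (\<forall>h. (a * A\<^sub>\<Phi> - \<mu>) * norm h \<le> norm (N h))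
      \<and> (\<forall>h. 1 / (b * B\<^sub>\<Phi> + \<mu>) * norm h \<le> norm (inv N h)
             \<and> norm (inv N h) \<le> 1 / (a * A\<^sub>\<Phi> - \<mu>) * norm h)
      \<and> op_sums (\<lambda>k. ((\<lambda>h. inv S (S h - N h)) ^^ k) \<circ> inv S) (inv N)" for N :: "'a \<Rightarrow> 'a"
  have good: "good N" if N: "bounded_clinear N" and close: "\<And>h. norm (S h - N h) \<le> \<mu> * norm h" for N
  proof -
    have bij_N: "bij N"
      using S bij_S N low_S close \<mu>
      by (intro bij_bounded_below_perturbation[of S N "a * A\<^sub>\<Phi>" \<mu>])
         (auto dest: bounded_clinear_linear bounded_linear.linear)
    have low: "(a * A\<^sub>\<Phi> - \<mu>) * norm h \<le> norm (N h)" for h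
      using low_S close by (rule perturbation_lower_bound)
    \<comment> \<open>The triangle inequality through \<open>S\<close>; evaluated at
      \<open>inv N h\<close>, this gives the lower estimate for the inverse.\<close>
    have up: "norm (N h) \<le> (b * B\<^sub>\<Phi> + \<mu>) * norm h" for h
      using up_S[of h] close[of h] norm_triangle_sub[of "N h" "S h"] norm_minus_commute[of "N h" "S h"]
      by (simp add: algebra_simps)
    have "1 / (b * B\<^sub>\<Phi> + \<mu>) * norm h \<le> norm (inv N h)" for h
    proof -
      have "0 < b * B\<^sub>\<Phi> + \<mu>" using \<open>0 < b\<close> pos \<mu> by (simp add: add_pos_nonneg)
      then show ?thesis
        using up[of "inv N h"] bij_N by (simp add: bij_is_surj surj_f_inv_f field_simps)
    qed
    moreover have "norm (inv N h) \<le> 1 / (a * A\<^sub>\<Phi> - \<mu>) * norm h" for h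
      using bij_N \<mu> low by (intro norm_inv_le) (simp_all add: bij_is_surj)
    moreover have "op_sums (\<lambda>k. ((\<lambda>h. inv S (S h - N h)) ^^ k) \<circ> inv S) (inv N)"
      using S bij_S N bij_N low_S close \<mu> by (rule neumann_series_op_sums)
    ultimately show ?thesis
      using N bij_N low by (simp add: good_def op_sums_def)
  qed
  have close\<^sub>1: "norm (S h - multiplier W \<Phi> \<Psi> h) \<le> \<mu> * norm h" for h
    using norm_multiplier_le[OF \<Phi> \<Delta> W, where f = h] multiplier_diff_right[OF \<Phi> \<Phi> \<Psi> W, where f = h]
    by (simp add: S_def \<mu>_def)
  have close\<^sub>2: "norm (S h - multiplier W \<Psi> \<Phi> h) \<le> \<mu> * norm h" for h
    using norm_multiplier_le[OF \<Delta> \<Phi> W, where f = h] multiplier_diff_left[OF \<Phi> \<Phi> \<Psi> W, where f = h]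
    by (simp add: S_def \<mu>_def mult.commute)
  have good\<^sub>1: "good (multiplier W \<Phi> \<Psi>)"
    using bounded_clinear_multiplier[OF \<Phi> \<Psi> W] close\<^sub>1 by (rule good)
  have good\<^sub>2: "good (multiplier W \<Psi> \<Phi>)"
    using bounded_clinear_multiplier[OF \<Psi> \<Phi> W] close\<^sub>2 by (rule good)

  have "is_frame \<Psi>"
  proof -
    \<comment> \<open>Obtained by solving \<open>(a * A\<^sub>\<Phi> - \<mu>) * norm h \<le> b *
      sqrt (B\<^sub>\<Phi> * s)\<close> for the coefficient sum \<open>s\<close>.\<close>
    define c where "c = ((a * A\<^sub>\<Phi> - \<mu>) / (b * sqrt B\<^sub>\<Phi>))\<^sup>2"
    have "0 < c" using \<mu> pos \<open>0 < b\<close> by (simp add: c_def)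
    have "c * (norm h)\<^sup>2 \<le> (\<Sum>n. (cmod (cinner h (\<Psi> n)))\<^sup>2)" for h
    proof -
      let ?s = "\<Sum>n. (cmod (cinner h (\<Psi> n)))\<^sup>2"
      have "0 \<le> ?s" using \<Psi> by (intro suminf_nonneg) (auto simp: bessel_bound_def)
      have "(a * A\<^sub>\<Phi> - \<mu>) * norm h \<le> norm (multiplier W \<Phi> \<Psi> h)"
        using good\<^sub>1 by (simp add: good_def)
      also have "\<dots> \<le> b * sqrt (B\<^sub>\<Phi> * ?s)"
        using \<Phi> \<Psi> W by (rule norm_multiplier_le_coefficients)
      finally have "(a * A\<^sub>\<Phi> - \<mu>) / (b * sqrt B\<^sub>\<Phi>) * norm h \<le> sqrt ?s"
        using \<open>0 < b\<close> pos by (simp add: real_sqrt_mult field_simps)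
      then have "((a * A\<^sub>\<Phi> - \<mu>) / (b * sqrt B\<^sub>\<Phi>) * norm h)\<^sup>2 \<le> (sqrt ?s)\<^sup>2"
        using \<mu> pos \<open>0 < b\<close> by (intro power_mono) simp_all
      then show ?thesis
        by (simp only: c_def power_mult_distrib real_sqrt_pow2[OF \<open>0 \<le> ?s\<close>])
    qed
    with \<Psi> \<open>0 < c\<close> show ?thesis
      unfolding is_frame_def frame_bounds_def by blast
  qed

  \<comment> \<open>Returns from \<open>W\<close> to the symbol \<open>m\<close>, which is
    \<open>W\<close> or \<open>- W\<close> according to the sign.\<close>
  moreover have result: "invertible_multiplier (\<lambda>n. complex_of_real (m n)) \<Xi> \<Theta> \<and>
      (let M = multiplier (\<lambda>n. complex_of_real (m n)) \<Xi> \<Theta> in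
        (\<forall>h. 1 / (b * B\<^sub>\<Phi> + \<mu>) * norm h \<le> norm (inv M h) \<and>
             norm (inv M h) \<le> 1 / (a * A\<^sub>\<Phi> - \<mu>) * norm h) \<and>
        ((\<forall>n. 0 < m n) \<longrightarrow>
          op_sums (\<lambda>k. ((\<lambda>h. inv S (S h - M h)) ^^ k) \<circ> inv S) (inv M)) \<and>
        ((\<forall>n. m n < 0) \<longrightarrow>
          (\<exists>T. op_sums (\<lambda>k. ((\<lambda>h. inv S (S h + M h)) ^^ k) \<circ> inv S) T \<and>
               inv M = (\<lambda>h. - T h))))"
    if g: "good (multiplier W \<Xi> \<Theta>)"
      and s: "\<And>f. summable (\<lambda>n. W n *\<^sub>C cinner f (\<Theta> n) *\<^sub>C \<Xi> n)" for \<Xi> \<Theta> :: "nat \<Rightarrow> 'a"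
    using sign
  proof
    assume p: "\<forall>n. 0 < m n"
    then have "(\<lambda>n. complex_of_real (m n)) = W"
      by (simp add: fun_eq_iff W_def w_def less_imp_le)
    \<comment> \<open>Makes the series formula for the opposite sign vacuous.\<close>
    moreover have "\<not> (\<forall>n. m n < 0)" using p by (meson less_asym)
    moreover have "invertible_multiplier W \<Xi> \<Theta>"
      using g s by (intro invertible_multiplierI) (simp_all add: good_def)
    ultimately show ?thesis using g by (auto simp: good_def Let_def)
  next
    assume n: "\<forall>n. m n < 0"
    let ?N = "multiplier W \<Xi> \<Theta>"
    have mW: "(\<lambda>n. complex_of_real (m n)) = (\<lambda>n. - W n)"
      using n by (simp add: fun_eq_iff W_def w_def less_imp_le)
    \<comment> \<open>Hence \<open>S h + M h\<close> for the symbol \<open>m\<close> equals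
      \<open>S h - ?N h\<close>: the series is the one already summed for \<open>?N\<close>, and the
      witness \<open>T\<close> is \<open>inv ?N\<close>.\<close>
    have M: "multiplier (\<lambda>n. - W n) \<Xi> \<Theta> = (\<lambda>h. - ?N h)"
      using multiplier_uminus[OF s] by blast
    have N: "linear ?N" "bij ?N"
      using g by (auto simp: good_def bounded_clinear_def bounded_linear.linear)
    note inv = inv_uminus[OF N]
    have "invertible_multiplier (\<lambda>n. - W n) \<Xi> \<Theta>"
    proof (rule invertible_multiplierI)
      show "summable (\<lambda>n. (- W n) *\<^sub>C cinner f (\<Theta> n) *\<^sub>C \<Xi> n)" for f
        using summable_minus[OF s] by simp
      show "bounded_clinear (inv (multiplier (\<lambda>n. - W n) \<Xi> \<Theta>))"
        unfolding M inv(2) using g by (intro bounded_clinear_minus) (simp add: good_def)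
    qed (simp add: M inv(1))
    moreover have "\<not> (\<forall>n. 0 < m n)" using n by (meson less_asym)
    ultimately show ?thesis
      using g unfolding mW by (auto simp: good_def Let_def M inv(2))
  qed
  moreover have "frame_operator (\<lambda>n. sqrt \<bar>m n\<bar> *\<^sub>R \<Phi> n) = S"
    using frame_operator_sqrt_weight[of w \<Phi>] by (simp add: S_def W_def[abs_def] w_def)
  moreover have "frame_operator (\<lambda>n. sqrt (m n) *\<^sub>R \<Phi> n) = S" if "\<forall>n. 0 < m n"
    using calculation(3) that by (simp add: abs_of_pos)
  ultimately show ?thesis
    using result[OF good\<^sub>1 multiplier_summable[OF \<Phi> \<Psi> W]]
      result[OF good\<^sub>2 multiplier_summable[OF \<Psi> \<Phi> W]]
    by (simp add: Let_def \<mu>_def)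
qed

end
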